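(* Let $M_1$ and $M_2$ be two closed subspaces of a complex Hilbert space $H$. Then $$W(P_{M_2}P_{M_1})\subset\left\{z\in\mathbb{C}: |\arg(1-z)|\le\arctan\left(\sqrt{\frac{\cos^2(M_1,M_2)}{4-\cos^2(M_1,M_2)}}\right)\right\}.$$
   Context: For a closed subspace $M$ of $H$, $P_M$ denotes the orthogonal projection of $H$ onto $M$. For a bounded operator $T$ on $H$, $W(T)=\{\langle Tx,x\rangle : x\in H,\ \|x\|=1\}$ is its numerical range. With $M=M_1\cap M_2$, the cosine of the Friedrichs angle between $M_1$ and $M_2$ is $\cos(M_1,M_2)=\sup\{|\langle x,y\rangle| : x\in M_1\cap M^\perp,\ y\in M_2\cap M^\perp,\ \|x\|=\|y\|=1\}$, with the convention that the supremum of the empty set is $0$. Here $\arg$ is the principal argument in $(-\pi,\pi]$, and the vertex $z=1$ is regarded as belonging to the sector (convention $\arg 0=0$). *)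

theory Defs
  imports "HOL-Analysis.Analysis"
begin

text \<open>
  A complex inner product space is presented as an extension of the library class
  \<^class>\<open>real_inner\<close>: the underlying real structure is the one obtained by restricting
  scalars to the reals and taking the real part of the complex inner product. In particular
  \<open>norm x = sqrt (Re (cinner x x))\<close>, and positive definiteness of \<open>cinner\<close> is inherited. The
  complex inner product is linear in its first and conjugate-linear in its second argument.
\<close>

class complex_inner = real_inner +
  fixes scaleC :: "complex \<Rightarrow> 'a \<Rightarrow> 'a"
    and cinner :: "'a \<Rightarrow> 'a \<Rightarrow> complex"
  assumes scaleC_add_right: "scaleC a (x + y) = scaleC a x + scaleC a y"
    and scaleC_add_left: "scaleC (a + b) x = scaleC a x + scaleC b x"
    and scaleC_scaleC: "scaleC a (scaleC b x) = scaleC (a * b) x"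
    and scaleR_scaleC: "scaleR r x = scaleC (complex_of_real r) x"
    and cinner_commute: "cinner x y = cnj (cinner y x)"
    and cinner_add_left: "cinner (x + y) z = cinner x z + cinner y z"
    and cinner_scaleC_left: "cinner (scaleC a x) y = a * cinner x y"
    and inner_eq_Re_cinner: "inner x y = Re (cinner x y)"

class complex_hilbert_space = complex_inner + complete_space

global_interpretation complex_vector:
  vector_space "scaleC :: complex \<Rightarrow> 'a \<Rightarrow> 'a::complex_inner"
  defines csubspace = complex_vector.subspace
proof
  show "scaleC 1 x = x" for x :: 'a
    using scaleR_scaleC[of 1 x] by simp
qed (simp_all add: scaleC_add_right scaleC_add_left scaleC_scaleC)

lemma cinner_self: "cinner x x = complex_of_real ((norm x)\<^sup>2)"
  for x :: "'a::complex_inner"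
proof (rule complex_eqI)
  show "Re (cinner x x) = Re (complex_of_real ((norm x)\<^sup>2))"
    by (simp add: power2_norm_eq_inner inner_eq_Re_cinner)
  show "Im (cinner x x) = Im (complex_of_real ((norm x)\<^sup>2))"
    using arg_cong[OF cinner_commute[of x x], of Im] by simp
qed

instantiation complex :: complex_hilbert_space
begin

definition "scaleC a x = a * (x :: complex)"
definition "cinner x y = x * cnj (y :: complex)"

instance
  by standard
    (simp_all add: scaleC_complex_def cinner_complex_def inner_complex_def
      algebra_simps scaleR_conv_of_real)

end

definition orth_compl :: "'a::complex_inner set \<Rightarrow> 'a set"
  where "orth_compl M = {x. \<forall>y\<in>M. cinner x y = 0}"

text \<open>For a closed subspace of a Hilbert space the point described below exists and is unique;
  for other sets the value is of no interest.\<close>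

definition orth_proj :: "'a::complex_inner set \<Rightarrow> 'a \<Rightarrow> 'a"
  where "orth_proj M x = (THE y. y \<in> M \<and> x - y \<in> orth_compl M)"

definition numerical_range :: "('a::complex_inner \<Rightarrow> 'a) \<Rightarrow> complex set"
  where "numerical_range T = {cinner (T x) x | x. norm x = 1}"

text \<open>The case distinction is needed because \<open>Sup {}\<close> is unspecified for real numbers.\<close>

definition friedrichs_cos :: "'a::complex_inner set \<Rightarrow> 'a set \<Rightarrow> real"
  where "friedrichs_cos M\<^sub>1 M\<^sub>2 =
    (let N = orth_compl (M\<^sub>1 \<inter> M\<^sub>2);
         S = {cmod (cinner x y) | x y.
                x \<in> M\<^sub>1 \<inter> N \<and> y \<in> M\<^sub>2 \<inter> N \<and> norm x = 1 \<and> norm y = 1}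
     in if S = {} then 0 else Sup S)"

end

theory Submission
  imports Defs
begin

text \<open>
  A point of the numerical range is \<open>z = \<langle>P\<^sub>2 P\<^sub>1 x, x\<rangle> = \<langle>P\<^sub>1 x, P\<^sub>2 x\<rangle>\<close> with \<open>x\<close> a unit vector. Let
  \<open>m\<close> be the projection of \<open>x\<close> onto \<open>M\<^sub>1 \<inter> M\<^sub>2\<close>. Removing \<open>m\<close> from \<open>x\<close> and from both of its
  projections turns the unit length of \<open>x\<close> into the identity \<open>1 - z = \<parallel>x\<parallel>\<^sup>2 - \<langle>u, v\<rangle>\<close>, where now \<open>u\<close>
  and \<open>v\<close> are orthogonal to \<open>M\<^sub>1 \<inter> M\<^sub>2\<close>, so that \<open>|\<langle>u, v\<rangle>| \<le> c \<parallel>u\<parallel> \<parallel>v\<parallel>\<close> with \<open>c\<close> the Friedrichs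
  cosine, while still \<open>\<langle>x, u\<rangle> = \<parallel>u\<parallel>\<^sup>2\<close> and \<open>\<langle>x, v\<rangle> = \<parallel>v\<parallel>\<^sup>2\<close>. As the half-angle of the sector has sine
  \<open>c / 2\<close>, the claim becomes \<open>\<surd>(4 - c\<^sup>2) |Im \<langle>u, v\<rangle>| \<le> c (\<parallel>x\<parallel>\<^sup>2 - Re \<langle>u, v\<rangle>)\<close>
  (\<open>sector_inequality\<close>).

  What makes this true is that the inner products of \<open>x\<close> with \<open>u\<close> and \<open>v\<close> determine the component of
  \<open>x\<close> in the span of \<open>u\<close> and \<open>v\<close>, hence bound \<open>\<parallel>x\<parallel>\<close> from below in terms of the Gram matrix of
  \<open>u\<close> and \<open>v\<close> (\<open>gram_inequality\<close>). After division by \<open>\<parallel>u\<parallel> \<parallel>v\<parallel>\<close> there remains an inequality between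
  real numbers, where \<open>\<langle>u, v\<rangle>\<close> has become \<open>p \<plusminus> \<i>q\<close> of modulus \<open>r \<le> c\<close>. It is a
  Cauchy-Schwarz inequality in the plane, on account of the identity \<open>r\<^sup>2 (3 - r\<^sup>2)\<^sup>2 + (1 - r\<^sup>2)\<^sup>2 (4 - r\<^sup>2) = 4\<close>
  (\<open>scalar_inequality\<close>).
\<close>

section \<open>Complex inner products\<close>

lemma cinner_add_right: "cinner x (y + z) = cinner x y + cinner x z"
  by (metis cinner_add_left cinner_commute complex_cnj_add)

lemma cinner_scaleC_right: "cinner x (scaleC a y) = cnj a * cinner x y"
  by (metis cinner_commute cinner_scaleC_left complex_cnj_mult)

lemma cinner_diff_left: "cinner (x - y) z = cinner x z - cinner y z"
  using cinner_add_left[of "x - y" y z] by simp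

lemma cinner_diff_right: "cinner x (y - z) = cinner x y - cinner x z"
  using cinner_add_right[of x "y - z" z] by simp

lemma csubspace_imp_subspace: "csubspace M \<Longrightarrow> subspace M"
  unfolding complex_vector.subspace_def subspace_def by (simp add: scaleR_scaleC)

lemma csubspace_diff: "csubspace M \<Longrightarrow> x \<in> M \<Longrightarrow> y \<in> M \<Longrightarrow> x - y \<in> M"
  by (simp add: csubspace_imp_subspace subspace_diff)

lemma csubspace_Int: "csubspace M \<Longrightarrow> csubspace N \<Longrightarrow> csubspace (M \<inter> N)"
  by (simp add: complex_vector.subspace_def)

lemma norm_scaleC: "norm (scaleC a x) = cmod a * norm x"
proof -
  have "complex_of_real ((norm (scaleC a x))\<^sup>2) = (a * cnj a) * cinner x x"
    using cinner_self[of "scaleC a x"] by (simp add: cinner_scaleC_left cinner_scaleC_right ac_simps)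
  also have "\<dots> = complex_of_real ((cmod a * norm x)\<^sup>2)"
    unfolding complex_norm_square[symmetric] cinner_self by (simp add: power_mult_distrib)
  finally have "complex_of_real ((norm (scaleC a x))\<^sup>2) = complex_of_real ((cmod a * norm x)\<^sup>2)" .
  then show ?thesis
    by (metis norm_ge_zero mult_nonneg_nonneg of_real_eq_iff power2_eq_imp_eq)
qed

text \<open>Rotating \<open>x\<close> by the phase of the inner product makes the latter real, and then it is the
  Cauchy-Schwarz inequality of the underlying real inner product space.\<close>

lemma cmod_cinner_le: "cmod (cinner x y) \<le> norm x * norm y"
proof -
  define w where "w = cinner x y"
  have "complex_of_real (cmod w * cmod w) = cinner (scaleC (cnj w) x) y"
    using complex_norm_square[of w]
    by (simp add: cinner_scaleC_left w_def[symmetric] power2_eq_square mult.commute)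
  then have "cmod w * cmod w = inner (scaleC (cnj w) x) y"
    by (metis Re_complex_of_real inner_eq_Re_cinner)
  also have "\<dots> \<le> cmod w * (norm x * norm y)"
    using norm_cauchy_schwarz[of "scaleC (cnj w) x" y] by (simp add: norm_scaleC mult.assoc)
  finally show ?thesis
    by (cases "w = 0") (auto simp: w_def)
qed

text \<open>The hypothesis says that \<open>x - y\<close> is orthogonal to \<open>y\<close>, which is how projections of \<open>x\<close>
  enter the estimates below.\<close>

lemma norm_le_if_cinner_eq:
  assumes "cinner x y = cinner y y"
  shows "norm y \<le> norm x"
proof -
  have "norm y * norm y \<le> norm x * norm y"
    using cmod_cinner_le[of x y] by (simp add: assms cinner_self norm_mult power2_eq_square)
  then show ?thesis by (cases "y = 0") auto
qed

section \<open>Orthogonal projections onto closed subspaces\<close>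

text \<open>A sequence in \<open>M\<close> that minimizes the distance to \<open>x\<close> is Cauchy by the parallelogram law:
  the midpoint of two of its members lies in \<open>M\<close> and so cannot be closer to \<open>x\<close> than the infimum.\<close>

lemma closest_point_exists:
  fixes x :: "'a::{real_inner,complete_space}"
  assumes "subspace M" "closed M"
  shows "\<exists>y\<in>M. \<forall>w\<in>M. norm (x - y) \<le> norm (x - w)"
proof -
  define d where "d = infdist x M"
  have ne: "M \<noteq> {}" using subspace_0[OF assms(1)] by auto
  have low: "d \<le> norm (x - w)" if "w \<in> M" for w
    using infdist_le[OF that, of x] by (simp add: d_def dist_norm)
  have "\<exists>w\<in>M. norm (x - w) < d + 1 / Suc n" for n
    using cInf_lessD[of "dist x ` M" "d + 1 / Suc n"] ne
    by (simp add: d_def infdist_notempty[OF ne] dist_norm)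
  then obtain f where fM: "\<And>n. f n \<in> M" and fd: "\<And>n. norm (x - f n) < d + 1 / Suc n"
    by metis
  have d0: "0 \<le> d" by (simp add: d_def infdist_nonneg)
  have lim: "(\<lambda>n. norm (x - f n)) \<longlonglongrightarrow> d"
  proof (rule tendsto_sandwich[OF _ _ tendsto_const])
    show "(\<lambda>n. d + 1 / Suc n) \<longlonglongrightarrow> d"
      using tendsto_add[OF tendsto_const[of d] LIMSEQ_Suc[OF lim_1_over_n]] by simp
    show "\<forall>\<^sub>F n in sequentially. d \<le> norm (x - f n)"
      using low fM by simp
    show "\<forall>\<^sub>F n in sequentially. norm (x - f n) \<le> d + 1 / Suc n"
      using fd less_imp_le by (blast intro: always_eventually)
  qed
  \<comment> \<open>The parallelogram law for \<open>x - f m\<close> and \<open>x - f n\<close>, with the sum bounded through the midpoint.\<close>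
  have par: "(norm (f m - f n))\<^sup>2 \<le> 2 * ((norm (x - f m))\<^sup>2 - d\<^sup>2) + 2 * ((norm (x - f n))\<^sup>2 - d\<^sup>2)" for m n
  proof -
    have "(1/2) *\<^sub>R (f m + f n) \<in> M"
      using assms(1) fM by (simp add: subspace_add subspace_scale)
    then have "d\<^sup>2 \<le> (norm (x - (1/2) *\<^sub>R (f m + f n)))\<^sup>2"
      using d0 low power_mono by blast
    moreover have "4 * (norm (x - (1/2) *\<^sub>R (f m + f n)))\<^sup>2 + (norm (f m - f n))\<^sup>2
        = 2 * (norm (x - f m))\<^sup>2 + 2 * (norm (x - f n))\<^sup>2"
      unfolding power2_norm_eq_inner by (simp add: algebra_simps inner_commute)
    ultimately show ?thesis by simp
  qed
  have "Cauchy f"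
  proof (rule metric_CauchyI)
    fix e :: real assume "0 < e"
    have "(\<lambda>n. (norm (x - f n))\<^sup>2) \<longlonglongrightarrow> d\<^sup>2"
      using lim by (intro tendsto_intros)
    then have "eventually (\<lambda>n. (norm (x - f n))\<^sup>2 < d\<^sup>2 + e\<^sup>2 / 4) sequentially"
      by (rule order_tendstoD(2)) (use \<open>0 < e\<close> in simp)
    then obtain N where N: "\<And>n. n \<ge> N \<Longrightarrow> (norm (x - f n))\<^sup>2 < d\<^sup>2 + e\<^sup>2 / 4"
      by (auto simp: eventually_sequentially)
    have "dist (f m) (f n) < e" if "m \<ge> N" "n \<ge> N" for m n
    proof -
      have "(norm (f m - f n))\<^sup>2 < e\<^sup>2"
        using par[of m n] N[OF that(1)] N[OF that(2)] by argo
      then show ?thesis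
        using \<open>0 < e\<close> by (simp add: dist_norm power_less_imp_less_base)
    qed
    then show "\<exists>N. \<forall>m\<ge>N. \<forall>n\<ge>N. dist (f m) (f n) < e" by blast
  qed
  then obtain y where y: "f \<longlonglongrightarrow> y"
    using Cauchy_convergent_iff convergent_def by blast
  have "y \<in> M"
    using closed_sequentially[OF assms(2) _ y] fM by blast
  moreover have "norm (x - y) = d"
    using LIMSEQ_unique[OF lim] tendsto_norm[OF tendsto_diff[OF tendsto_const y]] by metis
  ultimately show ?thesis
    using low by auto
qed

text \<open>The closest point of \<open>M\<close> does the job: moving it within \<open>M\<close> cannot shorten the difference,
  which makes the real part of each inner product vanish. The imaginary part is the real part for a
  vector of \<open>M\<close> multiplied by \<open>\<i>\<close>.\<close>

lemma orth_decomposition_exists: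
  fixes x :: "'a::complex_hilbert_space"
  assumes "csubspace M" "closed M"
  shows "\<exists>y\<in>M. x - y \<in> orth_compl M"
proof -
  note sub = csubspace_imp_subspace[OF assms(1)]
  obtain y where y: "y \<in> M" and min: "\<And>w. w \<in> M \<Longrightarrow> norm (x - y) \<le> norm (x - w)"
    using closest_point_exists[OF sub assms(2)] by blast
  have re: "inner (x - y) w = 0" if w: "w \<in> M" for w
  proof -
    \<comment> \<open>The value of \<open>t\<close> for which \<open>y + t w\<close> is nearest to \<open>x\<close>.\<close>
    define t where "t = inner (x - y) w / inner w w"
    have "y + t *\<^sub>R w \<in> M" using sub y w by (simp add: subspace_add subspace_scale)
    then have "(norm (x - y))\<^sup>2 \<le> (norm (x - (y + t *\<^sub>R w)))\<^sup>2"
      using min power_mono norm_ge_zero by blast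
    also have "\<dots> = (norm (x - y))\<^sup>2 - 2 * t * inner (x - y) w + t * t * inner w w"
      unfolding power2_norm_eq_inner by (simp add: algebra_simps inner_commute)
    finally have "2 * t * inner (x - y) w \<le> t * t * inner w w" by simp
    then show ?thesis
      by (cases "w = 0") (auto simp: t_def field_simps mult_le_0_iff not_sum_squares_lt_zero
          zero_le_mult_iff dest: antisym)
  qed
  have "cinner (x - y) w = 0" if w: "w \<in> M" for w
  proof (rule complex_eqI)
    show "Re (cinner (x - y) w) = Re 0"
      using re[OF w] by (simp add: inner_eq_Re_cinner)
    have "scaleC \<i> w \<in> M" using assms(1) w by (simp add: complex_vector.subspace_scale)
    from re[OF this] show "Im (cinner (x - y) w) = Im 0"
      by (simp add: inner_eq_Re_cinner cinner_scaleC_right)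
  qed
  then show ?thesis using y by (auto simp: orth_compl_def)
qed

lemma orth_proj:
  fixes x :: "'a::complex_hilbert_space"
  assumes "csubspace M" "closed M"
  shows orth_proj_mem: "orth_proj M x \<in> M"
    and orth_proj_orth: "y \<in> M \<Longrightarrow> cinner (x - orth_proj M x) y = 0"
proof -
  have "\<exists>!y. y \<in> M \<and> x - y \<in> orth_compl M"
  proof (rule ex_ex1I)
    fix y z assume y: "y \<in> M \<and> x - y \<in> orth_compl M" and z: "z \<in> M \<and> x - z \<in> orth_compl M"
    have "y - z \<in> M" using y z assms(1) csubspace_diff by blast
    then have "cinner (x - z) (y - z) - cinner (x - y) (y - z) = 0"
      using y z by (simp add: orth_compl_def)
    then have "cinner (y - z) (y - z) = 0"
      by (simp flip: cinner_diff_left)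
    then show "y = z" by (simp add: cinner_self)
  qed (use orth_decomposition_exists[OF assms] in blast)
  from theI'[OF this] have *: "orth_proj M x \<in> M \<and> x - orth_proj M x \<in> orth_compl M"
    unfolding orth_proj_def .
  then show "orth_proj M x \<in> M" by simp
  show "cinner (x - orth_proj M x) y = 0" if "y \<in> M"
    using * that by (simp add: orth_compl_def)
qed

section \<open>The Friedrichs cosine\<close>

lemma friedrichs_cos:
  fixes M N :: "'a::complex_hilbert_space set"
  shows friedrichs_cos_nonneg: "0 \<le> friedrichs_cos M N"
    and friedrichs_cos_le_1: "friedrichs_cos M N \<le> 1"
    and friedrichs_cos_unit: "\<And>x y. \<lbrakk>x \<in> M \<inter> orth_compl (M \<inter> N); y \<in> N \<inter> orth_compl (M \<inter> N);
      norm x = 1; norm y = 1\<rbrakk> \<Longrightarrow> cmod (cinner x y) \<le> friedrichs_cos M N"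
proof -
  define S where "S = {cmod (cinner x y) | x y. x \<in> M \<inter> orth_compl (M \<inter> N) \<and>
      y \<in> N \<inter> orth_compl (M \<inter> N) \<and> norm x = 1 \<and> norm y = 1}"
  have F: "friedrichs_cos M N = (if S = {} then 0 else Sup S)"
    unfolding friedrichs_cos_def S_def Let_def ..
  have le1: "s \<le> 1" if "s \<in> S" for s
    using that unfolding S_def by clarify (metis cmod_cinner_le mult_1)
  have ge0: "0 \<le> s" if "s \<in> S" for s
    using that by (auto simp: S_def)
  have bdd: "bdd_above S" using le1 by (rule bdd_aboveI)
  show "0 \<le> friedrichs_cos M N"
    using cSup_upper2[OF _ ge0 bdd] ge0 by (auto simp: F)
  show "friedrichs_cos M N \<le> 1"
    using cSup_least[OF _ le1] by (auto simp: F)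
  show "cmod (cinner x y) \<le> friedrichs_cos M N"
    if "x \<in> M \<inter> orth_compl (M \<inter> N)" "y \<in> N \<inter> orth_compl (M \<inter> N)" "norm x = 1" "norm y = 1" for x y
  proof -
    have "cmod (cinner x y) \<in> S" using that unfolding S_def by blast
    then show ?thesis using cSup_upper[OF _ bdd] by (auto simp: F)
  qed
qed

lemma csubspace_orth_compl: "csubspace (orth_compl M)"
  unfolding complex_vector.subspace_def orth_compl_def
  by (auto simp: cinner_add_left cinner_scaleC_left) (use cinner_diff_left[of 0 0] in simp)

lemma cmod_cinner_le_friedrichs:
  fixes M N :: "'a::complex_hilbert_space set"
  assumes "csubspace M" "csubspace N"
    and x: "x \<in> M" "x \<in> orth_compl (M \<inter> N)" and y: "y \<in> N" "y \<in> orth_compl (M \<inter> N)"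
  shows "cmod (cinner x y) \<le> friedrichs_cos M N * (norm x * norm y)"
proof (cases "x = 0 \<or> y = 0")
  case True
  then show ?thesis using cmod_cinner_le[of x y] by auto
next
  case False
  define x' y' where "x' = scaleC (1 / norm x) x" and "y' = scaleC (1 / norm y) y"
  have "cmod (cinner x' y') \<le> friedrichs_cos M N"
    using False x y csubspace_orth_compl[of "M \<inter> N"] assms(1,2)
    by (intro friedrichs_cos_unit)
      (auto simp: x'_def y'_def norm_scaleC norm_divide complex_vector.subspace_scale)
  then show ?thesis
    using False
    by (simp add: x'_def y'_def cinner_scaleC_left cinner_scaleC_right norm_mult norm_divide
        field_simps)
qed

section \<open>The sector inequality for a vector and two of its projections\<close>

text \<open>The inequality compares \<open>x\<close> with its projection onto the span of \<open>u\<close> and \<open>v\<close>: when the Gram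
  determinant \<open>D\<close> is positive, the squared length of that projection is
  \<open>\<parallel>u\<parallel>\<^sup>2 \<parallel>v\<parallel>\<^sup>2 \<parallel>u - v\<parallel>\<^sup>2 / D\<close>. The proof works with the vector \<open>y\<close> that is \<open>D\<close> times the projection.
  Its coefficients are given by the adjugate of the Gram matrix, so no division is needed and
  the inequality also covers linearly dependent \<open>u\<close> and \<open>v\<close>.\<close>

lemma gram_inequality:
  fixes x u v :: "'a::complex_inner"
  assumes xu: "cinner x u = cinner u u" and xv: "cinner x v = cinner v v"
  shows "(norm u)\<^sup>2 * (norm v)\<^sup>2 * (norm (u - v))\<^sup>2
    \<le> (norm x)\<^sup>2 * ((norm u)\<^sup>2 * (norm v)\<^sup>2 - (cmod (cinner u v))\<^sup>2)"
proof -
  define A B w where "A = (norm u)\<^sup>2" and "B = (norm v)\<^sup>2" and "w = cinner u v"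
  define a b where "a = A * B - cnj w * B" and "b = A * B - w * A"
  define y where "y = scaleC a u + scaleC b v"
  define D E where "D = A * B - (cmod w)\<^sup>2" and "E = (norm (u - v))\<^sup>2"
  have wc: "cinner v u = cnj w" using cinner_commute[of v u] by (simp add: w_def)
  have uu: "cinner u u = A" "cinner v v = B" by (simp_all add: cinner_self A_def B_def)
  have D: "complex_of_real D = A * B - w * cnj w"
    by (simp add: D_def complex_norm_square[symmetric] del: of_real_power)
  have E: "complex_of_real E = A + B - w - cnj w"
    unfolding E_def cinner_self[symmetric]
    by (simp add: cinner_diff_left cinner_diff_right uu wc w_def[symmetric])
  have y_left: "cinner y z = a * cinner u z + b * cinner v z" for z
    by (simp add: y_def cinner_add_left cinner_scaleC_left)
  have y_right: "cinner z y = cnj a * cinner z u + cnj b * cinner z v" for z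
    by (simp add: y_def cinner_add_right cinner_scaleC_right)
  have yu: "cinner y u = D * A" and yv: "cinner y v = D * B"
    by (simp_all add: y_left uu wc w_def[symmetric] a_def b_def D algebra_simps)
  have yx: "cinner x y = A * B * E"
    by (simp add: y_right xu xv uu a_def b_def E algebra_simps)
  have "complex_of_real ((norm y)\<^sup>2) = cinner y y"
    by (simp add: cinner_self)
  also have "\<dots> = complex_of_real (D * (A * B * E))"
    unfolding y_right[of y] yu yv by (simp add: a_def b_def E algebra_simps)
  finally have yy: "(norm y)\<^sup>2 = D * (A * B * E)" using of_real_eq_iff by blast
  have nn: "0 \<le> A" "0 \<le> B" "0 \<le> E" by (simp_all add: A_def B_def E_def)
  have "A * B * E \<le> norm x * norm y"
    using cmod_cinner_le[of x y] nn by (simp add: yx norm_mult)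
  then have "(A * B * E)\<^sup>2 \<le> (norm x * norm y)\<^sup>2"
    using nn by (intro power_mono) auto
  then have "(A * B * E) * (A * B * E) \<le> (A * B * E) * ((norm x)\<^sup>2 * D)"
    by (simp add: power_mult_distrib yy) (simp add: power2_eq_square algebra_simps)
  moreover have "0 \<le> D"
    using power_mono[OF cmod_cinner_le[of u v], of 2]
    by (simp add: D_def A_def B_def w_def power_mult_distrib)
  ultimately have "A * B * E \<le> (norm x)\<^sup>2 * D"
    using nn by (cases "A * B * E = 0") (auto simp: mult_le_cancel_left)
  then show ?thesis by (simp add: A_def B_def D_def E_def w_def)
qed

text \<open>Here \<open>p\<close>, \<open>q\<close> and \<open>r\<close> are the real part, the absolute value of the imaginary part and the
  modulus of the normalized inner product, and \<open>X\<close> is the normalized \<open>\<parallel>x\<parallel>\<^sup>2\<close>. If \<open>0 < r < 1\<close>, the lower bound on \<open>X\<close>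
  reduces the case \<open>c = r\<close> to \<open>r (3 - r\<^sup>2) p + (1 - r\<^sup>2) \<surd>(4 - r\<^sup>2) q \<le> 2 r\<close>. This is the Cauchy-Schwarz
  inequality in the plane, since \<open>(p, q)\<close> has length \<open>r\<close> and the vector of coefficients has
  length \<open>2\<close>. Enlarging \<open>c\<close> only widens the sector. If \<open>r = 1\<close>, the bound on \<open>X\<close> degenerates but
  forces \<open>p = 1\<close> and \<open>q = 0\<close>.\<close>

lemma scalar_inequality:
  fixes p q r c X :: real
  assumes r: "r\<^sup>2 = p\<^sup>2 + q\<^sup>2" "0 \<le> r" "r \<le> c" "c \<le> 1" and q: "0 \<le> q"
    and X: "1 \<le> X" and gram: "2 - 2 * p \<le> (1 - r\<^sup>2) * X"
  shows "sqrt (4 - c\<^sup>2) * q \<le> c * (X - p)"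
proof (cases "r = 0 \<or> r = 1")
  case True
  then show ?thesis
  proof
    assume "r = 0"
    then have "p = 0" "q = 0" using r by (auto simp: sum_power2_eq_zero_iff)
    then show ?thesis using r X by simp
  next
    assume "r = 1"
    then have "1 \<le> p" "p\<^sup>2 + q\<^sup>2 = 1" using gram r by auto
    then have "1 \<le> p\<^sup>2" "q\<^sup>2 = 1 - p\<^sup>2" by simp_all
    then have "p\<^sup>2 = 1" "q = 0"
      using zero_le_power2[of q] by (linarith, simp)
    then have "p = 1" "q = 0"
      using \<open>1 \<le> p\<close> by (auto simp: power2_eq_1_iff)
    then show ?thesis using r X by simp
  qed
next
  case False
  then have r': "0 < r" "r < 1" using r by auto
  then have D: "0 < 1 - r\<^sup>2" by (simp add: power_less_one_iff abs_square_less_1)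
  define s where "s = sqrt (4 - r\<^sup>2)"
  have s: "s\<^sup>2 = 4 - r\<^sup>2" "0 \<le> s" using D by (auto simp: s_def)
  define e where "e = r * (3 - r\<^sup>2) * p + (1 - r\<^sup>2) * s * q"
  \<comment> \<open>Lagrange's identity, the source of the Cauchy-Schwarz inequality.\<close>
  have "e\<^sup>2 + (r * (3 - r\<^sup>2) * q - (1 - r\<^sup>2) * s * p)\<^sup>2
      = (r\<^sup>2 * (3 - r\<^sup>2)\<^sup>2 + (1 - r\<^sup>2)\<^sup>2 * s\<^sup>2) * (p\<^sup>2 + q\<^sup>2)"
    unfolding e_def by algebra
  also have "\<dots> = (2 * r)\<^sup>2"
    unfolding s r(1)[symmetric] by algebra
  finally have "e\<^sup>2 \<le> (2 * r)\<^sup>2"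
    using zero_le_power2[of "r * (3 - r\<^sup>2) * q - (1 - r\<^sup>2) * s * p"] by linarith
  then have "e \<le> 2 * r" by (rule power2_le_imp_le) (use r'(1) in simp)
  moreover have "r * (2 - 2 * p) \<le> r * ((1 - r\<^sup>2) * X)" using gram r by (intro mult_left_mono)
  ultimately have "(1 - r\<^sup>2) * (s * q) \<le> (1 - r\<^sup>2) * (r * (X - p))"
    unfolding e_def by (simp add: algebra_simps)
  then have sq: "s * q \<le> r * (X - p)" using D by simp
  then have Xp: "0 \<le> X - p"
    by (metis r'(1) s(2) q mult_nonneg_nonneg order_trans zero_le_mult_iff not_less)
  have "sqrt (4 - c\<^sup>2) * q \<le> s * q"
    using power_mono[OF r(3,2), of 2] q unfolding s_def
    by (intro mult_right_mono real_sqrt_le_mono) simp_all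
  also have "\<dots> \<le> c * (X - p)"
    using sq mult_right_mono[OF r(3) Xp] by linarith
  finally show ?thesis .
qed

text \<open>Dividing by \<open>\<parallel>u\<parallel> \<parallel>v\<parallel>\<close> reduces the claim to \<open>scalar_inequality\<close>, whose lower bound on \<open>X\<close> is
  \<open>gram_inequality\<close>.\<close>

lemma sector_inequality:
  fixes x u v :: "'a::complex_inner"
  assumes xu: "cinner x u = cinner u u" and xv: "cinner x v = cinner v v"
    and c: "cmod (cinner u v) \<le> c * (norm u * norm v)" "0 \<le> c" "c \<le> 1"
  shows "sqrt (4 - c\<^sup>2) * \<bar>Im (cinner u v)\<bar> \<le> c * ((norm x)\<^sup>2 - Re (cinner u v))"
proof (cases "u = 0 \<or> v = 0")
  case True
  then have "cinner u v = 0" using cmod_cinner_le[of u v] by auto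
  then show ?thesis using c by simp
next
  case False
  define k where "k = norm u * norm v"
  have k: "0 < k" using False by (simp add: k_def)
  define w where "w = cinner u v"
  have "k \<le> (norm x)\<^sup>2"
    using norm_le_if_cinner_eq[OF xu] norm_le_if_cinner_eq[OF xv] unfolding k_def power2_eq_square
    by (intro mult_mono) auto
  then have X: "1 \<le> (norm x)\<^sup>2 / k" using k by simp
  have uv: "(norm (u - v))\<^sup>2 = (norm u)\<^sup>2 + (norm v)\<^sup>2 - 2 * Re w"
    unfolding power2_norm_eq_inner by (simp add: inner_diff_left inner_diff_right inner_commute w_def
        inner_eq_Re_cinner[symmetric])
  \<comment> \<open>For a given product of the norms of \<open>u\<close> and \<open>v\<close>, the distance is least when the norms
    agree.\<close>
  have "2 * k - 2 * Re w \<le> (norm (u - v))\<^sup>2"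
    unfolding uv k_def using zero_le_power2[of "norm u - norm v"] by (simp add: power2_diff)
  then have "k\<^sup>2 * (2 * k - 2 * Re w) \<le> k\<^sup>2 * (norm (u - v))\<^sup>2"
    by (intro mult_left_mono) auto
  also have "\<dots> \<le> (norm x)\<^sup>2 * (k\<^sup>2 - (cmod w)\<^sup>2)"
    using gram_inequality[OF xu xv] by (simp add: k_def w_def power_mult_distrib)
  finally have "k\<^sup>2 * (2 * k - 2 * Re w) / k ^ 3 \<le> (norm x)\<^sup>2 * (k\<^sup>2 - (cmod w)\<^sup>2) / k ^ 3"
    using k by (intro divide_right_mono) auto
  moreover have "k\<^sup>2 * (2 * k - 2 * Re w) / k ^ 3 = 2 - 2 * (Re w / k)"
    "(norm x)\<^sup>2 * (k\<^sup>2 - (cmod w)\<^sup>2) / k ^ 3 = (1 - (cmod w / k)\<^sup>2) * ((norm x)\<^sup>2 / k)"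
    using k by (simp_all add: field_simps power2_eq_square power3_eq_cube)
  ultimately have g: "2 - 2 * (Re w / k) \<le> (1 - (cmod w / k)\<^sup>2) * ((norm x)\<^sup>2 / k)"
    by simp
  have "sqrt (4 - c\<^sup>2) * (\<bar>Im w\<bar> / k) \<le> c * ((norm x)\<^sup>2 / k - Re w / k)"
  proof (rule scalar_inequality[OF _ _ _ c(3) _ X g])
    show "(cmod w / k)\<^sup>2 = (Re w / k)\<^sup>2 + (\<bar>Im w\<bar> / k)\<^sup>2"
      by (simp add: power_divide cmod_power2 add_divide_distrib)
    show "cmod w / k \<le> c" using c(1) k by (simp add: field_simps w_def k_def)
  qed (use k in auto)
  then show ?thesis using k by (simp add: field_simps w_def)
qed

section \<open>The numerical range of a product of two projections\<close>

text \<open>The hypotheses include \<open>z = 0\<close>, the vertex of the sector, where \<open>Arg 0 = 0\<close>.\<close>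

lemma abs_Arg_le_arctan:
  assumes "\<bar>Im z\<bar> \<le> t * Re z" "0 \<le> Re z" "0 \<le> t"
  shows "\<bar>Arg z\<bar> \<le> arctan t"
proof (cases "Re z = 0")
  case True
  then have "z = 0" using assms by (simp add: complex_eq_iff)
  then show ?thesis using assms by (simp add: Arg_zero)
next
  case False
  then have "0 < Re z" using assms by simp
  then have "Arg z = arctan (Im z / Re z)"
    by (rule arg_conv_arctan)
  moreover have "\<bar>arctan (Im z / Re z)\<bar> = arctan \<bar>Im z / Re z\<bar>"
    by (simp add: abs_if arctan_minus)
  moreover have "\<bar>Im z / Re z\<bar> \<le> t" using assms \<open>0 < Re z\<close> by (simp add: field_simps)
  ultimately show ?thesis by (simp add: arctan_le_iff)
qed

theorem proposition1p5:
  fixes M\<^sub>1 M\<^sub>2 :: "'a::complex_hilbert_space set"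
  assumes "csubspace M\<^sub>1" and "closed M\<^sub>1"
    and "csubspace M\<^sub>2" and "closed M\<^sub>2"
  shows "numerical_range (orth_proj M\<^sub>2 \<circ> orth_proj M\<^sub>1) \<subseteq>
    {z. \<bar>Arg (1 - z)\<bar> \<le>
        arctan (sqrt ((friedrichs_cos M\<^sub>1 M\<^sub>2)\<^sup>2 / (4 - (friedrichs_cos M\<^sub>1 M\<^sub>2)\<^sup>2)))}"
proof
  fix z assume "z \<in> numerical_range (orth_proj M\<^sub>2 \<circ> orth_proj M\<^sub>1)"
  then obtain x where z: "z = cinner (orth_proj M\<^sub>2 (orth_proj M\<^sub>1 x)) x" and x: "norm x = 1"
    by (auto simp: numerical_range_def)
  define c where "c = friedrichs_cos M\<^sub>1 M\<^sub>2"
  have c: "0 \<le> c" "c \<le> 1" by (simp_all add: c_def friedrichs_cos_nonneg friedrichs_cos_le_1)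
  have M: "csubspace (M\<^sub>1 \<inter> M\<^sub>2)" "closed (M\<^sub>1 \<inter> M\<^sub>2)"
    using assms by (simp_all add: csubspace_Int closed_Int)
  define m u v where "m = orth_proj (M\<^sub>1 \<inter> M\<^sub>2) x" and "u = orth_proj M\<^sub>1 x" and "v = orth_proj M\<^sub>2 x"
  have mem: "m \<in> M\<^sub>1" "m \<in> M\<^sub>2" "u \<in> M\<^sub>1" "v \<in> M\<^sub>2"
    using orth_proj_mem[OF M] orth_proj_mem[OF assms(1,2)] orth_proj_mem[OF assms(3,4)]
    by (auto simp: m_def u_def v_def)
  have xm: "cinner (x - m) y = 0" if "y \<in> M\<^sub>1" "y \<in> M\<^sub>2" for y
    using orth_proj_orth[OF M] that by (simp add: m_def)
  have xu: "cinner (x - u) y = 0" if "y \<in> M\<^sub>1" for y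
    using orth_proj_orth[OF assms(1,2) that] by (simp add: u_def)
  have xv: "cinner (x - v) y = 0" if "y \<in> M\<^sub>2" for y
    using orth_proj_orth[OF assms(3,4) that] by (simp add: v_def)
  have mem': "u - m \<in> M\<^sub>1" "v - m \<in> M\<^sub>2"
    using mem assms csubspace_diff by auto
  have orth: "u - m \<in> orth_compl (M\<^sub>1 \<inter> M\<^sub>2)" "v - m \<in> orth_compl (M\<^sub>1 \<inter> M\<^sub>2)"
    unfolding orth_compl_def using xm xu xv by (force simp: cinner_diff_left)+
  have zuv: "z = cinner u v"
  proof -
    let ?p = "orth_proj M\<^sub>2 u"
    have p: "?p \<in> M\<^sub>2" "cinner (u - ?p) v = 0"
      using orth_proj_mem[OF assms(3,4)] orth_proj_orth[OF assms(3,4) mem(4)] by auto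
    have "cinner ?p (x - v) = 0" using xv[OF p(1)] cinner_commute[of ?p "x - v"] by simp
    then have "cinner ?p x = cinner ?p v" by (simp add: cinner_diff_right)
    also have "\<dots> = cinner u v" using p(2) by (simp add: cinner_diff_left)
    finally show ?thesis by (simp add: z u_def)
  qed
  \<comment> \<open>By Pythagoras the summand \<open>\<parallel>m\<parallel>\<^sup>2\<close> occurs both in \<open>\<parallel>x\<parallel>\<^sup>2 = 1\<close> and in \<open>z\<close>, so it cancels in
    \<open>1 - z\<close>.\<close>
  have um: "cinner (u - m) m = 0" and vm: "cinner m (v - m) = 0"
    using orth mem cinner_commute[of m "v - m"] by (auto simp: orth_compl_def)
  have "cinner x x = cinner (x - m) (x - m) + cinner m m"
    using xm[OF mem(1,2)] cinner_commute[of m "x - m"]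
    by (simp add: cinner_diff_left cinner_diff_right)
  moreover have "cinner u v = cinner (u - m) (v - m) + cinner m m"
    using um vm by (simp add: cinner_diff_left cinner_diff_right)
  moreover have "cinner x x = 1" using x by (simp add: cinner_self)
  ultimately have "1 - z = cinner (x - m) (x - m) - cinner (u - m) (v - m)"
    by (simp add: zuv diff_eq_eq)
  then have z1: "1 - z = (norm (x - m))\<^sup>2 - cinner (u - m) (v - m)"
    unfolding cinner_self .
  have "cinner (x - m) (u - m) = cinner (u - m) (u - m)" "cinner (x - m) (v - m) = cinner (v - m) (v - m)"
    using xu[OF mem'(1)] xv[OF mem'(2)] by (simp_all add: cinner_diff_left)
  moreover have "cmod (cinner (u - m) (v - m)) \<le> c * (norm (u - m) * norm (v - m))"
    unfolding c_def by (intro cmod_cinner_le_friedrichs assms mem' orth)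
  ultimately have "sqrt (4 - c\<^sup>2) * \<bar>Im (1 - z)\<bar> \<le> c * Re (1 - z)"
    unfolding z1 using sector_inequality[of "x - m" "u - m" "v - m" c] c by simp
  moreover have c2: "c\<^sup>2 < 4" using c power_mono[of c 1 2] by simp
  ultimately have *: "\<bar>Im (1 - z)\<bar> \<le> c / sqrt (4 - c\<^sup>2) * Re (1 - z)"
    by (simp add: field_simps)
  \<comment> \<open>If \<open>c = 0\<close>, the estimate of the imaginary part carries no information on the sign of
    \<open>1 - Re z\<close>.\<close>
  have "norm u \<le> 1" "norm v \<le> 1"
    using norm_le_if_cinner_eq[of x u] norm_le_if_cinner_eq[of x v] xu[OF mem(3)] xv[OF mem(4)] x
    by (simp_all add: cinner_diff_left)
  then have "norm u * norm v \<le> 1" by (simp add: mult_le_one)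
  then have "Re z \<le> 1"
    using complex_Re_le_cmod[of z] cmod_cinner_le[of u v] unfolding zuv by linarith
  then have "\<bar>Arg (1 - z)\<bar> \<le> arctan (c / sqrt (4 - c\<^sup>2))"
    using * c c2 by (intro abs_Arg_le_arctan) auto
  then show "z \<in> {z. \<bar>Arg (1 - z)\<bar> \<le> arctan (sqrt ((friedrichs_cos M\<^sub>1 M\<^sub>2)\<^sup>2 / (4 - (friedrichs_cos M\<^sub>1 M\<^sub>2)\<^sup>2)))}"
    using c by (simp add: real_sqrt_divide flip: c_def)
qed

end
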